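(* Let $m\ge2$ and consider the system of differential equations on circles in $(m+1)$-dimensional Euclidean space, $$\dddot r_i=3\,\ddot r_i\,\frac{\sum_{j=1}^m\dot r_j\ddot r_j}{1+\sum_{j=1}^m\dot r_j^2},\qquad i=1,\dots,m,$$ that is, the system $y_i'''=f^i(x,y,y',y'')$ with $y_i=r_i$, $p_i=\dot r_i$, $q_i=\ddot r_i$ and $f^i=3q_i\,\frac{\sum_jp_jq_j}{1+\sum_jp_j^2}$. For this system the invariants $W_2$, $I_2$ and $W_3$ vanish identically, and the invariant $I_4$ has the form $$(I_4)_{i,j}=\frac12\,\delta_{ij}\,\frac1{1+\sum_{k=1}^m\dot r_k^2}-\frac12\,\frac{\dot r_i\dot r_j}{\big(1+\sum_{k=1}^m\dot r_k^2\big)^2}.$$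
   Context: For a system $y_i'''=f^i(x,y,p,q)$, $i=1,\dots,m$, with $p_i=y_i'$, $q_i=y_i''$, the invariants are (summation over repeated indices; upper and lower positions of coordinate indices not distinguished; here the independent variable $x$ is the parameter of the curve): $$(W_2)^i_j=\mathrm{tr}_0\Big(\frac{\partial f^i}{\partial p^j}-\frac{d}{dx}\frac{\partial f^i}{\partial q^j}+\frac13\frac{\partial f^i}{\partial q^k}\frac{\partial f^k}{\partial q^j}\Big),\qquad (I_2)^i_{j,k}=\mathrm{tr}_0\Big(\frac{\partial^2f^i}{\partial q^j\partial q^k}\Big),$$ $$(W_3)^i_j=\frac{\partial f^i}{\partial y^j}+\frac13\frac{\partial f^i}{\partial q^k}\frac{\partial f^k}{\partial p^j}-\frac12\frac{d}{dx}\frac{\partial f^i}{\partial p^j}+\frac16\frac{d^2}{dx^2}\frac{\partial f^i}{\partial q^j}+\frac2{27}\frac{\partial f^i}{\partial q^k}\frac{\partial f^k}{\partial q^l}\frac{\partial f^l}{\partial q^j}-\frac5{18}\frac{\partial f^i}{\partial q^k}\frac{d}{dx}\Big(\frac{\partial f^k}{\partial q^j}\Big)-\frac1{18}\frac{d}{dx}\Big(\frac{\partial f^i}{\partial q^k}\Big)\frac{\partial f^k}{\partial q^j},$$ $$(I_4)_{j,k}=-\frac{\partial H^{-1}_k}{\partial p^j}+\frac{\partial}{\partial q^j}\frac{\partial}{\partial q^k}H^x-\frac{\partial}{\partial q^k}\frac{d}{dx}H^{-1}_j-\frac{\partial}{\partial q^k}\Big(H^{-1}_l\frac{\partial f^l}{\partial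 q^j}\Big)+2H^{-1}_jH^{-1}_k,$$ where $H^{-1}_j=\frac1{6(m+1)}\frac{\partial^2f^i}{\partial q^i\partial q^j}$, $H^x=-\frac1{4m}\Big(\frac{\partial f^i}{\partial p^i}-\frac{d}{dx}\frac{\partial f^i}{\partial q^i}+\frac13\frac{\partial f^i}{\partial q^k}\frac{\partial f^k}{\partial q^i}\Big)$, and $\frac{d}{dx}=\frac{\partial}{\partial x}+p_i\frac{\partial}{\partial y_i}+q_i\frac{\partial}{\partial p_i}+f^i\frac{\partial}{\partial q_i}$. $\mathrm{tr}_0$ denotes the traceless part: $\mathrm{tr}_0(T^i_j)=T^i_j-\frac1m\delta^i_jT^l_l$, and for $T^i_{jk}$ symmetric in $j,k$, $\mathrm{tr}_0(T^i_{jk})=T^i_{jk}-\frac1{m+1}(\delta^i_jT^l_{lk}+\delta^i_kT^l_{lj})$. *)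

theory Defs
  imports "HOL-Analysis.Analysis"
begin

text \<open>
  A point of the jet space of a system \<open>y\<^sub>i''' = f\<^sup>i(x, y, p, q)\<close> is a tuple \<open>(x, y, p, q)\<close>, with
  \<open>p = y'\<close> and \<open>q = y''\<close>. The number \<open>m\<close> of equations is \<open>CARD('m)\<close>, and the system itself is
  the family \<open>f\<close> of its right-hand sides, indexed by \<open>'m\<close>.
\<close>

type_synonym 'm jet = "real \<times> (real ^ 'm) \<times> (real ^ 'm) \<times> (real ^ 'm)"

text \<open>
  The operators below use \<^const>\<open>deriv\<close>, which is unspecified where the derivative does not
  exist, so they are meaningful for functions that are sufficiently often differentiable.
\<close>

definition pd_x :: "('m::finite jet \<Rightarrow> real) \<Rightarrow> 'm jet \<Rightarrow> real" where
  "pd_x F = (\<lambda>(x, y, p, q). deriv (\<lambda>t. F (t, y, p, q)) x)"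

definition pd_y :: "'m::finite \<Rightarrow> ('m jet \<Rightarrow> real) \<Rightarrow> 'm jet \<Rightarrow> real" where
  "pd_y j F = (\<lambda>(x, y, p, q). deriv (\<lambda>t. F (x, y + t *\<^sub>R axis j 1, p, q)) 0)"

definition pd_p :: "'m::finite \<Rightarrow> ('m jet \<Rightarrow> real) \<Rightarrow> 'm jet \<Rightarrow> real" where
  "pd_p j F = (\<lambda>(x, y, p, q). deriv (\<lambda>t. F (x, y, p + t *\<^sub>R axis j 1, q)) 0)"

definition pd_q :: "'m::finite \<Rightarrow> ('m jet \<Rightarrow> real) \<Rightarrow> 'm jet \<Rightarrow> real" where
  "pd_q j F = (\<lambda>(x, y, p, q). deriv (\<lambda>t. F (x, y, p, q + t *\<^sub>R axis j 1)) 0)"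

text \<open>The total derivative \<open>d/dx\<close> along the solutions of the system \<open>f\<close>.\<close>

definition total_deriv :: "('m::finite \<Rightarrow> 'm jet \<Rightarrow> real) \<Rightarrow> ('m jet \<Rightarrow> real) \<Rightarrow> 'm jet \<Rightarrow> real" where
  "total_deriv f F = (\<lambda>(x, y, p, q).
     pd_x F (x, y, p, q)
     + (\<Sum>i\<in>UNIV. p $ i * pd_y i F (x, y, p, q))
     + (\<Sum>i\<in>UNIV. q $ i * pd_p i F (x, y, p, q))
     + (\<Sum>i\<in>UNIV. f i (x, y, p, q) * pd_q i F (x, y, p, q)))"

text \<open>
  Traceless parts of a tensor \<open>T\<^sup>i\<^sub>j\<close> and of a tensor \<open>T\<^sup>i\<^sub>j\<^sub>k\<close> symmetric in \<open>j, k\<close>; the upper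
  index is the first argument.
\<close>

definition tr0 :: "('m::finite \<Rightarrow> 'm \<Rightarrow> real) \<Rightarrow> 'm \<Rightarrow> 'm \<Rightarrow> real" where
  "tr0 T i j = T i j - 1 / real CARD('m) * of_bool (i = j) * (\<Sum>l\<in>UNIV. T l l)"

definition tr0_sym :: "('m::finite \<Rightarrow> 'm \<Rightarrow> 'm \<Rightarrow> real) \<Rightarrow> 'm \<Rightarrow> 'm \<Rightarrow> 'm \<Rightarrow> real" where
  "tr0_sym T i j k = T i j k - 1 / (real CARD('m) + 1) *
     (of_bool (i = j) * (\<Sum>l\<in>UNIV. T l l k) + of_bool (i = k) * (\<Sum>l\<in>UNIV. T l l j))"

definition W2 :: "('m::finite \<Rightarrow> 'm jet \<Rightarrow> real) \<Rightarrow> 'm \<Rightarrow> 'm \<Rightarrow> 'm jet \<Rightarrow> real" where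
  "W2 f i j z = tr0 (\<lambda>i j.
       pd_p j (f i) z
       - total_deriv f (pd_q j (f i)) z
       + 1/3 * (\<Sum>k\<in>UNIV. pd_q k (f i) z * pd_q j (f k) z)) i j"

definition I2 :: "('m::finite \<Rightarrow> 'm jet \<Rightarrow> real) \<Rightarrow> 'm \<Rightarrow> 'm \<Rightarrow> 'm \<Rightarrow> 'm jet \<Rightarrow> real" where
  "I2 f i j k z = tr0_sym (\<lambda>i j k. pd_q j (pd_q k (f i)) z) i j k"

definition W3 :: "('m::finite \<Rightarrow> 'm jet \<Rightarrow> real) \<Rightarrow> 'm \<Rightarrow> 'm \<Rightarrow> 'm jet \<Rightarrow> real" where
  "W3 f i j z =
       pd_y j (f i) z
       + 1/3 * (\<Sum>k\<in>UNIV. pd_q k (f i) z * pd_p j (f k) z)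
       - 1/2 * total_deriv f (pd_p j (f i)) z
       + 1/6 * total_deriv f (total_deriv f (pd_q j (f i))) z
       + 2/27 * (\<Sum>k\<in>UNIV. \<Sum>l\<in>UNIV. pd_q k (f i) z * pd_q l (f k) z * pd_q j (f l) z)
       - 5/18 * (\<Sum>k\<in>UNIV. pd_q k (f i) z * total_deriv f (pd_q j (f k)) z)
       - 1/18 * (\<Sum>k\<in>UNIV. total_deriv f (pd_q k (f i)) z * pd_q j (f k) z)"

text \<open>The functions \<open>H\<^sup>-\<^sup>1\<^sub>j\<close> and \<open>H\<^sup>x\<close>; the superscripts are labels, not exponents.\<close>

definition Hm1 :: "('m::finite \<Rightarrow> 'm jet \<Rightarrow> real) \<Rightarrow> 'm \<Rightarrow> 'm jet \<Rightarrow> real" where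
  "Hm1 f j z = 1 / (6 * (real CARD('m) + 1)) * (\<Sum>i\<in>UNIV. pd_q i (pd_q j (f i)) z)"

definition Hx :: "('m::finite \<Rightarrow> 'm jet \<Rightarrow> real) \<Rightarrow> 'm jet \<Rightarrow> real" where
  "Hx f z = - 1 / (4 * real CARD('m)) *
     ((\<Sum>i\<in>UNIV. pd_p i (f i) z)
      - (\<Sum>i\<in>UNIV. total_deriv f (pd_q i (f i)) z)
      + 1/3 * (\<Sum>i\<in>UNIV. \<Sum>k\<in>UNIV. pd_q k (f i) z * pd_q i (f k) z))"

definition I4 :: "('m::finite \<Rightarrow> 'm jet \<Rightarrow> real) \<Rightarrow> 'm \<Rightarrow> 'm \<Rightarrow> 'm jet \<Rightarrow> real" where
  "I4 f j k z =
       - pd_p j (Hm1 f k) z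
       + pd_q j (pd_q k (Hx f)) z
       - pd_q k (total_deriv f (Hm1 f j)) z
       - pd_q k (\<lambda>z. \<Sum>l\<in>UNIV. Hm1 f l z * pd_q j (f l) z) z
       + 2 * Hm1 f j z * Hm1 f k z"

text \<open>The system of circles in Euclidean space of dimension \<open>m + 1\<close>, with \<open>r = y\<close>.\<close>

definition circle_system :: "'m::finite \<Rightarrow> 'm jet \<Rightarrow> real" where
  "circle_system i = (\<lambda>(x, y, p, q).
     3 * q $ i * ((\<Sum>j\<in>UNIV. p $ j * q $ j) / (1 + (\<Sum>j\<in>UNIV. (p $ j)\<^sup>2))))"

end

theory Submission
  imports Defs
begin

text \<open>
  With \<open>D = 1 + |p|\<^sup>2\<close>, \<open>u = p/D\<close>, \<open>v = q/D\<close>, \<open>g = u \<bullet> q\<close> and \<open>h = v \<bullet> q\<close> the system is \<open>f = 3 g q\<close>, and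
  along its solutions \<open>u' = v - 2 g u\<close>, \<open>v' = g v\<close>, \<open>g' = h + g\<^sup>2\<close>, \<open>h' = 4 g h\<close>. Hence all matrices that
  enter the invariants have the form \<open>a \<cdot> 1 + q w\<^sup>T\<close> with \<open>w\<close> in the span of \<open>u\<close> and \<open>v\<close>, and they
  multiply by the rule in \<open>rank1_mult\<close>.
\<close>

section \<open>Jet coordinates and the functions built from them\<close>

definition jet_p :: "'m::finite jet \<Rightarrow> real ^ 'm" where "jet_p z = fst (snd (snd z))"
definition jet_q :: "'m::finite jet \<Rightarrow> real ^ 'm" where "jet_q z = snd (snd (snd z))"

lemma jet_sel [simp]: "jet_p (x, y, p, q) = p" "jet_q (x, y, p, q) = q"
  by (simp_all add: jet_p_def jet_q_def)

definition den :: "'m::finite jet \<Rightarrow> real" where "den z = 1 + jet_p z \<bullet> jet_p z"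
definition uvec :: "'m::finite jet \<Rightarrow> real ^ 'm" where "uvec z = inverse (den z) *\<^sub>R jet_p z"
definition vvec :: "'m::finite jet \<Rightarrow> real ^ 'm" where "vvec z = inverse (den z) *\<^sub>R jet_q z"
definition gfun :: "'m::finite jet \<Rightarrow> real" where "gfun z = uvec z \<bullet> jet_q z"
definition hfun :: "'m::finite jet \<Rightarrow> real" where "hfun z = vvec z \<bullet> jet_q z"

lemma den_pos [simp]: "den z > 0" "den z \<noteq> 0"
proof -
  show "den z > 0" by (simp add: den_def add_pos_nonneg)
  then show "den z \<noteq> 0" by simp
qed

lemma circle_system_eq: "circle_system i = (\<lambda>z. 3 * gfun z * jet_q z $ i)"
proof -
  have "gfun z = (jet_p z \<bullet> jet_q z) / den z" for z :: "'a jet"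
    by (simp add: gfun_def uvec_def divide_inverse_commute)
  then show ?thesis
    by (auto simp: circle_system_def fun_eq_iff den_def inner_vec_def power2_eq_square)
qed

section \<open>Partial and total derivatives as values of the Frechet derivative\<close>

lemma
  assumes "(F has_derivative F') (at z)"
  shows pd_x_eq: "pd_x F z = F' (1, 0, 0, 0)"
    and pd_y_eq: "pd_y j F z = F' (0, axis j 1, 0, 0)"
    and pd_p_eq: "pd_p j F z = F' (0, 0, axis j 1, 0)"
    and pd_q_eq: "pd_q j F z = F' (0, 0, 0, axis j 1)"
proof -
  obtain x y p q where z: "z = (x, y, p, q)" by (cases z)
  have lin: "linear F'"
    using assms has_derivative_linear by blast
  \<comment> \<open>Chain rule along a line \<open>c\<close> through \<open>z\<close> with velocity
    \<open>d\<close>. The parameter \<open>t0\<close> is free because \<open>pd_x\<close>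
    differentiates at \<open>t = x\<close>, the other operators at \<open>t = 0\<close>.\<close>
  have *: "deriv (\<lambda>t. F (c t)) t0 = F' d"
    if "c t0 = z" "(c has_derivative (\<lambda>t. t *\<^sub>R d)) (at t0)" for c d and t0 :: real
  proof -
    have "((\<lambda>t. F (c t)) has_derivative (\<lambda>t. F' (t *\<^sub>R d))) (at t0)"
      using has_derivative_compose[OF that(2), of F F'] assms that(1) by simp
    moreover have "(\<lambda>t. F' (t *\<^sub>R d)) = (*) (F' d)"
      by (auto simp: fun_eq_iff linear_cmul[OF lin])
    ultimately have "((\<lambda>t. F (c t)) has_field_derivative F' d) (at t0)"
      by (simp add: has_field_derivative_def)
    then show ?thesis by (rule DERIV_imp_deriv)
  qed
  show "pd_x F z = F' (1, 0, 0, 0)"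
    unfolding pd_x_def z prod.case
    by (rule *) (auto intro!: derivative_eq_intros simp: z zero_prod_def)
  show "pd_y j F z = F' (0, axis j 1, 0, 0)"
    unfolding pd_y_def z prod.case
    by (rule *) (auto intro!: derivative_eq_intros simp: z zero_prod_def)
  show "pd_p j F z = F' (0, 0, axis j 1, 0)"
    unfolding pd_p_def z prod.case
    by (rule *) (auto intro!: derivative_eq_intros simp: z zero_prod_def)
  show "pd_q j F z = F' (0, 0, 0, axis j 1)"
    unfolding pd_q_def z prod.case
    by (rule *) (auto intro!: derivative_eq_intros simp: z zero_prod_def)
qed

text \<open>By linearity of \<open>F'\<close> the weighted coordinate derivatives add up to a single
  value of \<open>F'\<close>, so one derivative computation serves all operators.\<close>

lemma total_deriv_eq:
  assumes "(F has_derivative F') (at z)"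
  shows "total_deriv f F z = F' (1, jet_p z, jet_q z, \<chi> i. f i z)"
proof -
  obtain x y p q where z: "z = (x, y, p, q)" by (cases z)
  have lin: "linear F'"
    using assms has_derivative_linear by blast
  have expand: "(\<Sum>i\<in>UNIV. w $ i * F' (e i)) = F' (\<Sum>i\<in>UNIV. w $ i *\<^sub>R e i)"
    for w :: "real ^ 'a" and e
    by (simp add: linear_sum[OF lin] linear_cmul[OF lin])
  have basis: "(\<Sum>i\<in>UNIV. w $ i *\<^sub>R axis i 1) = w" for w :: "real ^ 'a"
    using basis_expansion[of w] by (simp add: scalar_mult_eq_scaleR)
  have y: "(\<Sum>i\<in>UNIV. w $ i *\<^sub>R (0::real, axis i 1 :: real ^ 'a, 0 :: real ^ 'a, 0 :: real ^ 'a)) = (0, w, 0, 0)"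
    and p: "(\<Sum>i\<in>UNIV. w $ i *\<^sub>R (0::real, 0 :: real ^ 'a, axis i 1 :: real ^ 'a, 0 :: real ^ 'a)) = (0, 0, w, 0)"
    and q: "(\<Sum>i\<in>UNIV. w $ i *\<^sub>R (0::real, 0 :: real ^ 'a, 0 :: real ^ 'a, axis i 1 :: real ^ 'a)) = (0, 0, 0, w)"
    for w :: "real ^ 'a"
    by (simp_all add: prod_eq_iff fst_sum snd_sum basis)
  have "total_deriv f F z = F' (1, 0, 0, 0) + (\<Sum>i\<in>UNIV. p $ i * F' (0, axis i 1, 0, 0))
      + (\<Sum>i\<in>UNIV. q $ i * F' (0, 0, axis i 1, 0))
      + (\<Sum>i\<in>UNIV. (\<chi> i. f i z) $ i * F' (0, 0, 0, axis i 1))"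
    using assms
    by (simp add: total_deriv_def z pd_x_eq pd_y_eq pd_p_eq pd_q_eq)
  also have "\<dots> = F' (1, jet_p z, jet_q z, \<chi> i. f i z)"
    unfolding expand y p q linear_add[OF lin, symmetric] by (simp add: z)
  finally show ?thesis .
qed

section \<open>Derivatives of the building blocks\<close>

lemma jet_p_deriv [derivative_intros]: "(jet_p has_derivative jet_p) (at z)"
  unfolding jet_p_def[abs_def] by (auto intro!: derivative_eq_intros)

lemma jet_q_deriv [derivative_intros]: "(jet_q has_derivative jet_q) (at z)"
  unfolding jet_q_def[abs_def] by (auto intro!: derivative_eq_intros)

lemmas vec_nth_deriv [derivative_intros] = bounded_linear.has_derivative[OF bounded_linear_vec_nth]

text \<open>One factor \<open>inverse (den z)\<close> is absorbed into \<open>uvec z\<close>; thus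
  all later derivatives stay polynomial in \<open>inverse (den z)\<close>, \<open>uvec\<close>,
  \<open>vvec\<close>, \<open>gfun\<close>, \<open>hfun\<close> and the jet coordinates.\<close>

lemma inverse_den_deriv [derivative_intros]:
  "((\<lambda>z. inverse (den z)) has_derivative (\<lambda>w. - 2 * inverse (den z) * (uvec z \<bullet> jet_p w))) (at z)"
proof -
  have "(den has_derivative (\<lambda>w. 2 * (jet_p z \<bullet> jet_p w))) (at z)"
    unfolding den_def[abs_def] by (auto intro!: derivative_eq_intros simp: inner_commute)
  from Deriv.has_derivative_inverse[OF den_pos(2) this]
  show ?thesis
    by (rule has_derivative_eq_rhs) (simp add: uvec_def fun_eq_iff)
qed

lemma uvec_deriv [derivative_intros]:
  "(uvec has_derivative (\<lambda>w. inverse (den z) *\<^sub>R jet_p w - (2 * (uvec z \<bullet> jet_p w)) *\<^sub>R uvec z)) (at z)"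
  unfolding uvec_def[of z] uvec_def[abs_def]
  by (rule derivative_eq_intros refl)+ (simp add: fun_eq_iff uvec_def algebra_simps)

lemma vvec_deriv [derivative_intros]:
  "(vvec has_derivative (\<lambda>w. inverse (den z) *\<^sub>R jet_q w - (2 * (uvec z \<bullet> jet_p w)) *\<^sub>R vvec z)) (at z)"
  unfolding vvec_def[abs_def]
  by (rule derivative_eq_intros refl)+ (simp add: fun_eq_iff vvec_def algebra_simps)

lemma gfun_deriv [derivative_intros]:
  "(gfun has_derivative (\<lambda>w. vvec z \<bullet> jet_p w + uvec z \<bullet> jet_q w - 2 * gfun z * (uvec z \<bullet> jet_p w))) (at z)"
  unfolding gfun_def[abs_def]
  by (rule derivative_eq_intros refl)+
    (simp add: fun_eq_iff gfun_def vvec_def inner_simps inner_commute)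

lemma hfun_deriv [derivative_intros]:
  "(hfun has_derivative (\<lambda>w. 2 * (vvec z \<bullet> jet_q w) - 2 * hfun z * (uvec z \<bullet> jet_p w))) (at z)"
  unfolding hfun_def[abs_def]
  by (rule derivative_eq_intros refl)+
    (simp add: fun_eq_iff hfun_def vvec_def inner_simps inner_commute)

lemma inner_uv:
  "uvec z \<bullet> jet_q z = gfun z" "vvec z \<bullet> jet_q z = hfun z" "vvec z \<bullet> jet_p z = gfun z"
  "jet_q z \<bullet> uvec z = gfun z" "jet_q z \<bullet> vvec z = hfun z"
  by (simp_all add: gfun_def hfun_def uvec_def vvec_def inner_commute)

section \<open>Scalar plus rank-one matrices\<close>

definition rank1 :: "real \<Rightarrow> real ^ 'm \<Rightarrow> real ^ 'm \<Rightarrow> 'm::finite \<Rightarrow> 'm \<Rightarrow> real" where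
  "rank1 a c w i j = a * of_bool (i = j) + c $ i * w $ j"

text \<open>Both factors share the column \<open>c\<close>, so (c w^T)(c t^T) = (w . c) c t^T and
  the product keeps this column; longer products follow by iteration.\<close>

lemma rank1_mult:
  "(\<Sum>k\<in>UNIV. rank1 a c w i k * rank1 b c t k j) = rank1 (a * b) c ((a + w \<bullet> c) *\<^sub>R t + b *\<^sub>R w) i j"
proof -
  have "rank1 a c w i k * rank1 b c t k j =
    (if k = i then a * rank1 b c t i j else 0) + (if k = j then b * c $ i * w $ j else 0)
     + c $ i * t $ j * (w $ k * c $ k)" for k
    by (auto simp: rank1_def algebra_simps)
  then have "(\<Sum>k\<in>UNIV. rank1 a c w i k * rank1 b c t k j) =
    a * rank1 b c t i j + b * c $ i * w $ j + c $ i * t $ j * (w \<bullet> c)"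
    by (simp add: sum.distrib sum_distrib_left[symmetric] inner_vec_def)
  then show ?thesis
    by (simp add: rank1_def algebra_simps)
qed

lemma axis_nth_of_bool: "axis j (1::real) $ i = of_bool (i = j)"
  by (simp add: axis_def)

section \<open>Derivatives of the circle system\<close>

lemma pd_q_circle:
  "pd_q j (circle_system i) = (\<lambda>z. rank1 (3 * gfun z) (jet_q z) (3 *\<^sub>R uvec z) i j)"
proof
  fix z :: "'a jet"
  show "pd_q j (circle_system i) z = rank1 (3 * gfun z) (jet_q z) (3 *\<^sub>R uvec z) i j"
    unfolding circle_system_eq
    by (rule pd_q_eq[THEN trans], (rule derivative_eq_intros refl)+)
      (simp add: rank1_def jet_p_def jet_q_def inner_axis axis_nth_of_bool)
qed

lemma pd_p_circle:
  "pd_p j (circle_system i) = (\<lambda>z. rank1 0 (jet_q z) (3 *\<^sub>R vvec z - (6 * gfun z) *\<^sub>R uvec z) i j)"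
proof
  fix z :: "'a jet"
  show "pd_p j (circle_system i) z = rank1 0 (jet_q z) (3 *\<^sub>R vvec z - (6 * gfun z) *\<^sub>R uvec z) i j"
    unfolding circle_system_eq
    by (rule pd_p_eq[THEN trans], (rule derivative_eq_intros refl)+)
      (simp add: rank1_def jet_p_def jet_q_def inner_axis algebra_simps)
qed

lemma pd_y_circle: "pd_y j (circle_system i) z = 0"
  unfolding circle_system_eq
  by (rule pd_y_eq[THEN trans], (rule derivative_eq_intros refl)+) (simp add: jet_p_def jet_q_def)

text \<open>The vector field d/dx of the circle system, as a tangent vector at
  \<open>z\<close>.\<close>

definition prolong :: "'m::finite jet \<Rightarrow> 'm jet" where
  "prolong z = (1, jet_p z, jet_q z, \<chi> i. circle_system i z)"

lemma jet_prolong: "jet_p (prolong z) = jet_q z" "jet_q (prolong z) = (3 * gfun z) *\<^sub>R jet_q z"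
  by (simp_all add: prolong_def circle_system_eq vec_eq_iff jet_p_def jet_q_def)

lemmas td_eq = total_deriv_eq[of _ _ _ circle_system, folded prolong_def]

text \<open>Along solutions q' = 3 g q, so differentiating the column only rescales it; the factor 3
  g moves into the row vector and the matrix form survives.\<close>

lemma total_deriv_rank1:
  assumes "(a has_derivative a') (at z)" "(w has_derivative w') (at z)"
  shows "total_deriv circle_system (\<lambda>z. rank1 (a z) (jet_q z) (w z) i j) z =
    rank1 (a' (prolong z)) (jet_q z) (w' (prolong z) + (3 * gfun z) *\<^sub>R w z) i j"
  unfolding rank1_def
  by (rule td_eq[THEN trans], (rule derivative_eq_intros assms refl)+)
    (simp add: jet_prolong algebra_simps)

lemma vvec_eq: "inverse (den z) *\<^sub>R jet_q z = vvec z" "inverse (den z) * jet_q z $ j = vvec z $ j"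
  by (simp_all add: vvec_def)

lemma td_pd_q_circle:
  "total_deriv circle_system (pd_q j (circle_system i)) =
    (\<lambda>z. rank1 (3 * (hfun z + (gfun z)\<^sup>2)) (jet_q z) ((3 * gfun z) *\<^sub>R uvec z + 3 *\<^sub>R vvec z) i j)"
  unfolding pd_q_circle
  by (rule ext, rule total_deriv_rank1[THEN trans], (rule derivative_eq_intros refl)+)
    (simp add: jet_prolong inner_uv vvec_eq rank1_def algebra_simps power2_eq_square)

lemma td_td_pd_q_circle:
  "total_deriv circle_system (total_deriv circle_system (pd_q j (circle_system i))) z =
    rank1 (18 * gfun z * hfun z + 6 * gfun z ^ 3) (jet_q z)
      ((3 * hfun z + 6 * (gfun z)\<^sup>2) *\<^sub>R uvec z + (15 * gfun z) *\<^sub>R vvec z) i j"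
  unfolding td_pd_q_circle
  by (rule total_deriv_rank1[THEN trans], (rule derivative_eq_intros refl)+)
    (simp add: jet_prolong inner_uv vvec_eq rank1_def algebra_simps power2_eq_square power3_eq_cube)

lemma td_pd_p_circle:
  "total_deriv circle_system (pd_p j (circle_system i)) z =
    rank1 0 (jet_q z) ((6 * gfun z) *\<^sub>R vvec z - (6 * hfun z + 12 * (gfun z)\<^sup>2) *\<^sub>R uvec z) i j"
  unfolding pd_p_circle
  by (rule total_deriv_rank1[THEN trans], (rule derivative_eq_intros refl)+)
    (simp add: jet_prolong inner_uv vvec_eq rank1_def algebra_simps power2_eq_square)

section \<open>Vanishing of \<open>W2\<close>, \<open>I2\<close> and \<open>W3\<close>\<close>

lemma W2_matrix:
  "pd_p j (circle_system i) z - total_deriv circle_system (pd_q j (circle_system i)) z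
    + 1/3 * (\<Sum>k\<in>UNIV. pd_q k (circle_system i) z * pd_q j (circle_system k) z)
    = - 3 * hfun z * of_bool (i = j)"
  unfolding td_pd_q_circle pd_p_circle unfolding pd_q_circle rank1_mult
  \<comment> \<open>The rows cancel, (3 v - 6 g u) - (3 g u + 3 v) + 9 g u = 0, and the scalars
    leave -3 (h + g^2) + 3 g^2 = -3 h.\<close>
  by (simp add: rank1_def inner_uv algebra_simps power2_eq_square)

lemma W2_circle: "W2 circle_system i j z = 0"
  unfolding W2_def W2_matrix by (simp add: tr0_def)

lemma pd_q_pd_q_circle:
  "pd_q j (pd_q k (circle_system i)) z =
    3 * of_bool (i = j) * uvec z $ k + 3 * of_bool (i = k) * uvec z $ j"
  unfolding pd_q_circle rank1_def
  by (rule pd_q_eq[THEN trans], (rule derivative_eq_intros refl)+)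
    (simp add: jet_p_def jet_q_def inner_axis axis_nth_of_bool)

text \<open>The diagonal Kronecker delta contributes m and the other one 1; the factor m + 1 cancels
  the normalisations in \<open>tr0_sym\<close> and \<open>Hm1\<close>.\<close>

lemma trace_pd_q_pd_q_circle:
  fixes z :: "'m::finite jet"
  shows "(\<Sum>l\<in>UNIV. pd_q l (pd_q k (circle_system l)) z) = 3 * (real CARD('m) + 1) * uvec z $ k"
proof -
  have "pd_q l (pd_q k (circle_system l)) z = 3 * uvec z $ k + (if l = k then 3 * uvec z $ k else 0)" for l
    by (simp add: pd_q_pd_q_circle)
  then show ?thesis by (simp add: sum.distrib algebra_simps)
qed

text \<open>The second q-derivatives are built from Kronecker deltas and u alone, hence are pure
  trace.\<close>

lemma I2_circle: "I2 circle_system i j k z = 0"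
proof -
  have *: "pd_q k (pd_q j (circle_system i)) z = pd_q j (pd_q k (circle_system i)) z" for i j k
    by (simp add: pd_q_pd_q_circle)
  show ?thesis
    unfolding I2_def tr0_sym_def trace_pd_q_pd_q_circle
    by (simp add: pd_q_pd_q_circle field_simps)
qed

text \<open>The scalar parts sum to (3 g h + g^3) + 2 g^3 - (5/2 + 1/2)(g h + g^3) = 0; in the row
  vector the coefficients of u and v cancel likewise.\<close>

lemma W3_circle: "W3 circle_system i j z = 0"
proof -
  \<comment> \<open>Bracketing the cube as M (M M) lets \<open>rank1_mult\<close> apply
    twice.\<close>
  have cube: "(\<Sum>k\<in>UNIV. \<Sum>l\<in>UNIV. pd_q k (circle_system i) z * pd_q l (circle_system k) z * pd_q j (circle_system l) z)
    = (\<Sum>k\<in>UNIV. pd_q k (circle_system i) z * (\<Sum>l\<in>UNIV. pd_q l (circle_system k) z * pd_q j (circle_system l) z))"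
    by (simp add: sum_distrib_left mult.assoc)
  show ?thesis
    \<comment> \<open>The order matters: the rules for total derivatives match on unexpanded inner
      derivatives, so the outermost ones are rewritten first.\<close>
    unfolding W3_def cube td_td_pd_q_circle td_pd_p_circle pd_y_circle unfolding td_pd_q_circle
    unfolding pd_p_circle pd_q_circle rank1_mult
    by (simp add: rank1_def inner_uv inner_simps algebra_simps power2_eq_square power3_eq_cube)
qed

section \<open>The invariant \<open>I4\<close>\<close>

lemma Hm1_circle: "Hm1 circle_system j = (\<lambda>z. 1/2 * uvec z $ j)"
  unfolding Hm1_def[abs_def] trace_pd_q_pd_q_circle by (simp add: fun_eq_iff field_simps)

lemma Hx_circle: "Hx circle_system = (\<lambda>z::'m::finite jet. 3/4 * hfun z)"
proof
  fix z :: "'m jet"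
  have "Hx circle_system z = - 1 / (4 * real CARD('m)) * (\<Sum>i\<in>UNIV. - 3 * hfun z * of_bool (i = (i::'m)))"
    \<comment> \<open>The bracket in \<open>Hx\<close> is the trace of the matrix whose traceless
      part is \<open>W2\<close>, so it equals -3 m h.\<close>
    unfolding Hx_def W2_matrix[symmetric] by (simp add: sum.distrib sum_subtractf sum_distrib_left)
  then show "Hx circle_system z = 3/4 * hfun z" by simp
qed

lemma I4_circle:
  "I4 circle_system i j z = of_bool (i = j) * inverse (den z) / 2 - uvec z $ i * uvec z $ j / 2"
proof -
  have 1: "pd_p i (Hm1 circle_system j) z = of_bool (i = j) * inverse (den z) / 2 - uvec z $ i * uvec z $ j"
    unfolding Hm1_circle
    by (rule pd_p_eq[THEN trans], (rule derivative_eq_intros refl)+)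
      (simp add: jet_p_def jet_q_def inner_axis axis_nth_of_bool)
  have pd_Hx: "pd_q j (Hx circle_system) = (\<lambda>z. 3/2 * vvec z $ j)"
    unfolding Hx_circle
    by (rule ext, rule pd_q_eq[THEN trans], (rule derivative_eq_intros refl)+)
      (simp add: jet_p_def jet_q_def inner_axis)
  have 2: "pd_q i (pd_q j (Hx circle_system)) z = 3/2 * of_bool (i = j) * inverse (den z)"
    unfolding pd_Hx
    by (rule pd_q_eq[THEN trans], (rule derivative_eq_intros refl)+)
      (simp add: jet_p_def jet_q_def inner_axis axis_nth_of_bool)
  have td_Hm1: "total_deriv circle_system (Hm1 circle_system i) = (\<lambda>z. 1/2 * vvec z $ i - gfun z * uvec z $ i)"
    unfolding Hm1_circle
    by (rule ext, rule td_eq[THEN trans], (rule derivative_eq_intros refl)+)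
      (simp add: jet_prolong inner_uv vvec_eq algebra_simps)
  have 3: "pd_q j (total_deriv circle_system (Hm1 circle_system i)) z =
      of_bool (i = j) * inverse (den z) / 2 - uvec z $ i * uvec z $ j"
    unfolding td_Hm1
    by (rule pd_q_eq[THEN trans], (rule derivative_eq_intros refl)+)
      (simp add: jet_p_def jet_q_def inner_axis axis_nth_of_bool)
  have contr: "(\<Sum>l\<in>UNIV. Hm1 circle_system l z * pd_q i (circle_system l) z) = 3 * gfun z * uvec z $ i" for z
  proof -
    \<comment> \<open>The scalar part and the rank-one part each contribute 3/2 g u, the latter
      because u . q = g.\<close>
    have "(\<Sum>l\<in>UNIV. Hm1 circle_system l z * pd_q i (circle_system l) z)
      = (\<Sum>l\<in>UNIV. (if l = i then 3/2 * gfun z * uvec z $ i else 0) + 3/2 * uvec z $ i * (uvec z $ l * jet_q z $ l))"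
      by (rule sum.cong) (auto simp: Hm1_circle pd_q_circle rank1_def algebra_simps)
    also have "\<dots> = 3/2 * gfun z * uvec z $ i + 3/2 * uvec z $ i * (uvec z \<bullet> jet_q z)"
      by (simp add: sum.distrib sum_distrib_left inner_vec_def)
    finally show ?thesis by (simp add: inner_uv)
  qed
  have 4: "pd_q j (\<lambda>z. \<Sum>l\<in>UNIV. Hm1 circle_system l z * pd_q i (circle_system l) z) z =
      3 * uvec z $ i * uvec z $ j"
    unfolding contr
    by (rule pd_q_eq[THEN trans], (rule derivative_eq_intros refl)+)
      (simp add: jet_p_def jet_q_def inner_axis)
  show ?thesis
    \<comment> \<open>The coefficient of the delta term over \<open>den z\<close> is -1/2 + 3/2 -
      1/2 = 1/2, that of u_i u_j is 1 + 1 - 3 + 1/2 = -1/2.\<close>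
    by (simp only: I4_def 1 2 3 4) (simp add: Hm1_circle)
qed

theorem proposition2:
  fixes x :: real and y p q :: "real ^ 'm::finite"
  assumes "CARD('m) \<ge> 2"
  shows "(\<forall>i j. W2 circle_system i j (x, y, p, q) = 0)
    \<and> (\<forall>i j k. I2 circle_system i j k (x, y, p, q) = 0)
    \<and> (\<forall>i j. W3 circle_system i j (x, y, p, q) = 0)
    \<and> (\<forall>i j. I4 circle_system i j (x, y, p, q) =
          1/2 * of_bool (i = j) * (1 / (1 + (\<Sum>k\<in>UNIV. (p $ k)\<^sup>2)))
          - 1/2 * (p $ i * p $ j / (1 + (\<Sum>k\<in>UNIV. (p $ k)\<^sup>2))\<^sup>2))"
proof -
  have den: "1 + (\<Sum>k\<in>UNIV. (p $ k)\<^sup>2) = den (x, y, p, q)"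
    by (simp add: den_def inner_vec_def power2_eq_square)
  have uu: "uvec (x, y, p, q) $ i * uvec (x, y, p, q) $ j = p $ i * p $ j / (den (x, y, p, q))\<^sup>2" for i j
    by (simp add: uvec_def divide_inverse power2_eq_square)
  show ?thesis
    unfolding den I4_circle uu
    by (intro conjI allI W2_circle I2_circle W3_circle) (simp add: inverse_eq_divide)
qed

end
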